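(* Let $T_1,\dots,T_n$ be metric trees, each containing more than one point. Then $\dim_{\rm N}(T_1 \times \ldots \times T_n) = n$.
   Context: A family $(B_i)_{i\in I}$ of subsets of a metric space $X=(X,d)$ is called $D$-bounded ($D \ge 0$) if $\operatorname{diam} B_i := \sup\{d(x,x') : x,x'\in B_i\} \le D$ for all $i$. For $s>0$, the $s$-multiplicity of the family is the infimum of all integers $n \ge 0$ such that every subset of $X$ with diameter $\le s$ meets at most $n$ members of the family. The Nagata dimension $\dim_{\rm N} X$ of a metric space $X$ is the infimum of all integers $n$ with the following property: there exists a constant $c>0$ such that for all $s>0$, $X$ has a $cs$-bounded covering with $s$-multiplicity at most $n+1$ (the value is $\infty$ if there is no such $n$). A metric tree is a geodesic metric space such that every geodesic triangle is degenerate, in the sense that each side of the triangle is contained in the union of the remaining two; no local finiteness or compactness is assumed. Products of metric spaces carry the $\ell^2$ product metric. *)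

theory Defs
  imports "HOL-Analysis.Analysis"
begin

section \<open>Nagata dimension\<close>

text \<open>The diameter takes values in the extended reals, so that unbounded sets have diameter
  \<open>\<infinity>\<close>; the diameter of the empty set is \<open>-\<infinity>\<close>, which is
  harmless since diameters are only ever bounded from above by nonnegative numbers.\<close>

definition mdiam :: "'a metric \<Rightarrow> 'a set \<Rightarrow> ereal" where
  "mdiam X B = Sup {ereal (mdist X x x') | x x'. x \<in> B \<and> x' \<in> B}"

definition bounded_family :: "'a metric \<Rightarrow> real \<Rightarrow> 'i set \<Rightarrow> ('i \<Rightarrow> 'a set) \<Rightarrow> bool" where
  "bounded_family X D I B \<longleftrightarrow> (\<forall>i\<in>I. mdiam X (B i) \<le> ereal D)"

definition covering_family :: "'a metric \<Rightarrow> 'i set \<Rightarrow> ('i \<Rightarrow> 'a set) \<Rightarrow> bool" where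
  "covering_family X I B \<longleftrightarrow> (\<forall>i\<in>I. B i \<subseteq> mspace X) \<and> (\<Union>i\<in>I. B i) = mspace X"

text \<open>Members of a family are counted by index. The infimum is \<open>\<infinity>\<close> if no
  natural number qualifies.\<close>

definition multiplicity_at :: "'a metric \<Rightarrow> real \<Rightarrow> 'i set \<Rightarrow> ('i \<Rightarrow> 'a set) \<Rightarrow> enat" where
  "multiplicity_at X s I B =
     Inf {enat n | n. \<forall>S. S \<subseteq> mspace X \<and> mdiam X S \<le> ereal s \<longrightarrow>
            finite {i\<in>I. B i \<inter> S \<noteq> {}} \<and> card {i\<in>I. B i \<inter> S \<noteq> {}} \<le> n}"

text \<open>A type of indices cannot be quantified existentially in HOL, so the coverings below are
  indexed by sets of subsets. This is no restriction: see \<open>covering_reindex\<close>.\<close>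

definition nagata_dim :: "'a metric \<Rightarrow> ereal" where
  "nagata_dim X =
     Inf {ereal (real_of_int n) | n :: int.
       \<exists>c>0. \<forall>s>0. \<exists>(I :: 'a set set) (B :: 'a set \<Rightarrow> 'a set).
         covering_family X I B \<and> bounded_family X (c * s) I B \<and>
         ereal_of_enat (multiplicity_at X s I B) \<le> ereal (real_of_int (n + 1))}"

lemma covering_reindex:
  fixes I :: "'i set" and B :: "'i \<Rightarrow> 'a set"
  assumes "covering_family X I B" and "bounded_family X D I B"
  shows "covering_family X (B ` I) (\<lambda>A. A)" and "bounded_family X D (B ` I) (\<lambda>A. A)"
    and "multiplicity_at X s (B ` I) (\<lambda>A. A) \<le> multiplicity_at X s I B"
proof -
  show "covering_family X (B ` I) (\<lambda>A. A)" "bounded_family X D (B ` I) (\<lambda>A. A)"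
    using assms by (auto simp: covering_family_def bounded_family_def)
  have img: "{A \<in> B ` I. A \<inter> S \<noteq> {}} = B ` {i\<in>I. B i \<inter> S \<noteq> {}}" for S
    by auto
  show "multiplicity_at X s (B ` I) (\<lambda>A. A) \<le> multiplicity_at X s I B"
    unfolding multiplicity_at_def img
  proof (rule Inf_superset_mono, rule subsetI)
    fix m
    assume "m \<in> {enat n | n. \<forall>S. S \<subseteq> mspace X \<and> mdiam X S \<le> ereal s \<longrightarrow>
            finite {i\<in>I. B i \<inter> S \<noteq> {}} \<and> card {i\<in>I. B i \<inter> S \<noteq> {}} \<le> n}"
    then obtain n where m: "m = enat n" and n: "\<forall>S. S \<subseteq> mspace X \<and> mdiam X S \<le> ereal s \<longrightarrow>
            finite {i\<in>I. B i \<inter> S \<noteq> {}} \<and> card {i\<in>I. B i \<inter> S \<noteq> {}} \<le> n"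
      by blast
    have "finite (B ` {i\<in>I. B i \<inter> S \<noteq> {}}) \<and> card (B ` {i\<in>I. B i \<inter> S \<noteq> {}}) \<le> n"
      if "S \<subseteq> mspace X \<and> mdiam X S \<le> ereal s" for S
      using n that by (meson card_image_le finite_imageI order_trans)
    with m show "m \<in> {enat n | n. \<forall>S. S \<subseteq> mspace X \<and> mdiam X S \<le> ereal s \<longrightarrow>
            finite (B ` {i\<in>I. B i \<inter> S \<noteq> {}}) \<and> card (B ` {i\<in>I. B i \<inter> S \<noteq> {}}) \<le> n}"
      by blast
  qed
qed


section \<open>Metric trees\<close>

definition geodesic_segment :: "'a metric \<Rightarrow> 'a \<Rightarrow> 'a \<Rightarrow> 'a set \<Rightarrow> bool" where
  "geodesic_segment X x y S \<longleftrightarrow>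
     (\<exists>g :: real \<Rightarrow> 'a. g ` {0..mdist X x y} = S \<and> S \<subseteq> mspace X \<and>
        g 0 = x \<and> g (mdist X x y) = y \<and>
        (\<forall>t\<in>{0..mdist X x y}. \<forall>u\<in>{0..mdist X x y}. mdist X (g t) (g u) = \<bar>t - u\<bar>))"

definition geodesic_space :: "'a metric \<Rightarrow> bool" where
  "geodesic_space X \<longleftrightarrow>
     (\<forall>x\<in>mspace X. \<forall>y\<in>mspace X. \<exists>S. geodesic_segment X x y S)"

definition geodesic_triangle ::
    "'a metric \<Rightarrow> 'a set \<Rightarrow> 'a set \<Rightarrow> 'a set \<Rightarrow> bool" where
  "geodesic_triangle X P Q R \<longleftrightarrow>
     (\<exists>x\<in>mspace X. \<exists>y\<in>mspace X. \<exists>z\<in>mspace X.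
        geodesic_segment X x y P \<and> geodesic_segment X y z Q \<and> geodesic_segment X z x R)"

definition metric_tree :: "'a metric \<Rightarrow> bool" where
  "metric_tree X \<longleftrightarrow> geodesic_space X \<and>
     (\<forall>P Q R. geodesic_triangle X P Q R \<longrightarrow>
        P \<subseteq> Q \<union> R \<and> Q \<subseteq> P \<union> R \<and> R \<subseteq> P \<union> Q)"


section \<open>Finite products with the $\ell^2$ metric\<close>

definition l2_product :: "'i set \<Rightarrow> ('i \<Rightarrow> 'a metric) \<Rightarrow> ('i \<Rightarrow> 'a) metric" where
  "l2_product I T =
     metric (\<Pi>\<^sub>E i\<in>I. mspace (T i), \<lambda>x y. L2_set (\<lambda>i. mdist (T i) (x i) (y i)) I)"

lemma Metric_space_l2_product:
  assumes "finite I"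
  shows "Metric_space (\<Pi>\<^sub>E i\<in>I. mspace (T i)) (\<lambda>x y. L2_set (\<lambda>i. mdist (T i) (x i) (y i)) I)"
proof
  fix x y z assume x: "x \<in> (\<Pi>\<^sub>E i\<in>I. mspace (T i))" and y: "y \<in> (\<Pi>\<^sub>E i\<in>I. mspace (T i))"
    and z: "z \<in> (\<Pi>\<^sub>E i\<in>I. mspace (T i))"
  have "L2_set (\<lambda>i. mdist (T i) (x i) (z i)) I
      \<le> L2_set (\<lambda>i. mdist (T i) (x i) (y i) + mdist (T i) (y i) (z i)) I"
    using x y z by (intro L2_set_mono) (auto intro!: mdist_triangle simp: PiE_mem)
  also have "\<dots> \<le> L2_set (\<lambda>i. mdist (T i) (x i) (y i)) I + L2_set (\<lambda>i. mdist (T i) (y i) (z i)) I"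
    by (rule L2_set_triangle_ineq)
  finally show "L2_set (\<lambda>i. mdist (T i) (x i) (z i)) I
      \<le> L2_set (\<lambda>i. mdist (T i) (x i) (y i)) I + L2_set (\<lambda>i. mdist (T i) (y i) (z i)) I" .
next
  fix x y assume x: "x \<in> (\<Pi>\<^sub>E i\<in>I. mspace (T i))" and y: "y \<in> (\<Pi>\<^sub>E i\<in>I. mspace (T i))"
  have "L2_set (\<lambda>i. mdist (T i) (x i) (y i)) I = 0 \<longleftrightarrow> (\<forall>i\<in>I. x i = y i)"
    unfolding L2_set_eq_0_iff[OF assms]
    by (intro ball_cong refl mdist_zero PiE_mem[OF x] PiE_mem[OF y])
  also have "\<dots> \<longleftrightarrow> x = y"
    by (metis PiE_ext[OF x y])
  finally show "L2_set (\<lambda>i. mdist (T i) (x i) (y i)) I = 0 \<longleftrightarrow> x = y" .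
next
  fix x y
  show "0 \<le> L2_set (\<lambda>i. mdist (T i) (x i) (y i)) I"
    by (rule L2_set_nonneg)
  show "L2_set (\<lambda>i. mdist (T i) (x i) (y i)) I = L2_set (\<lambda>i. mdist (T i) (y i) (x i)) I"
    by (subst mdist_commute) (rule refl)
qed

lemma mspace_l2_product:
  "finite I \<Longrightarrow> mspace (l2_product I T) = (\<Pi>\<^sub>E i\<in>I. mspace (T i))"
  unfolding l2_product_def by (rule Metric_space.mspace_metric[OF Metric_space_l2_product])

lemma mdist_l2_product:
  "finite I \<Longrightarrow> mdist (l2_product I T) x y = L2_set (\<lambda>i. mdist (T i) (x i) (y i)) I"
  unfolding l2_product_def by (simp add: Metric_space.mdist_metric[OF Metric_space_l2_product])

end

theory Submission
  imports Defs
begin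

text \<open>The upper bound rests on the 0-hyperbolicity of trees. Fix a root in a tree, cut the
  distance to the root into slices of height \<open>s\<close> and colour these cyclically with
  \<open>n + 1\<close> colours. Deleting the slices of one colour leaves annuli at distance more than
  \<open>s\<close> from each other. Within an annulus, points whose geodesics to the root merge
  only well below the annulus are far apart, and the others are close; by the ultrametric
  inequality for Gromov products (\<open>metric_tree_gromov_product\<close>), closeness in this sense
  is an equivalence relation. So every colour yields a family of uniformly bounded sets that are
  more than \<open>s\<close> apart, and every point of the tree is missed by just one of the
  \<open>n + 1\<close> families (\<open>metric_tree_separated_partitions\<close>). A point of a product of
  \<open>n\<close> trees has \<open>n\<close> coordinates and so at most \<open>n\<close> missing colours;
  some colour is available in all coordinates at once. The products of the families of each colour
  therefore cover, and a set of diameter at most \<open>s\<close> meets at most one member per colour,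
  hence at most \<open>n + 1\<close> members.

  The lower bound is Lebesgue's covering theorem. A geodesic in each factor produces a cube
  \<open>[0, l]\<^sup>n\<close> in the product. If the members of a covering are too small to reach from one
  face of the cube to the opposite one, assigning to each point of a fine grid a member that
  contains it is a colouring to which Sperner's lemma, in Kuhn's form for the grid, applies: the
  vertices of some small simplex lie in \<open>n + 1\<close> different members
  (\<open>grid_colouring_rainbow_simplex\<close>). Hence a \<open>c s\<close>-bounded covering with
  \<open>c s < l\<close> has \<open>s\<close>-multiplicity greater than \<open>n\<close>.\<close>

section \<open>Diameter and multiplicity\<close>

lemma mdiam_le_iff:
  "mdiam X B \<le> ereal D \<longleftrightarrow> (\<forall>x\<in>B. \<forall>y\<in>B. mdist X x y \<le> D)"
proof -
  have "{ereal (mdist X x x') | x x'. x \<in> B \<and> x' \<in> B} = (\<lambda>(x, y). ereal (mdist X x y)) ` (B \<times> B)"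
    by auto
  then show ?thesis
    unfolding mdiam_def by (simp add: SUP_le_iff)
qed

text \<open>A set of extended naturals with finite infimum contains it, so a finite multiplicity is
  attained.\<close>

lemma multiplicity_at_le_iff:
  "multiplicity_at X s I B \<le> enat k \<longleftrightarrow>
     (\<forall>S. S \<subseteq> mspace X \<longrightarrow> (\<forall>x\<in>S. \<forall>y\<in>S. mdist X x y \<le> s) \<longrightarrow>
        finite {i\<in>I. B i \<inter> S \<noteq> {}} \<and> card {i\<in>I. B i \<inter> S \<noteq> {}} \<le> k)" (is "?l \<longleftrightarrow> ?r k")
proof
  let ?A = "{enat n | n. \<forall>S. S \<subseteq> mspace X \<and> mdiam X S \<le> ereal s \<longrightarrow>
            finite {i\<in>I. B i \<inter> S \<noteq> {}} \<and> card {i\<in>I. B i \<inter> S \<noteq> {}} \<le> n}"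
  assume l: ?l
  have "?A \<noteq> {}"
  proof
    assume "?A = {}"
    then have "multiplicity_at X s I B = top"
      unfolding multiplicity_at_def by (simp only: Inf_empty)
    with l show False by (simp add: top_enat_def)
  qed
  then have "Inf ?A \<in> ?A"
    by (metis (no_types, lifting) LeastI_ex Inf_enat_def ex_in_conv)
  then obtain m where "multiplicity_at X s I B = enat m" "?r m"
    unfolding multiplicity_at_def mdiam_le_iff by auto
  with l show "?r k"
    by (metis (no_types, lifting) enat_ord_simps(1) order_trans)
next
  assume "?r k"
  then show ?l
    unfolding multiplicity_at_def mdiam_le_iff by (intro Inf_lower) auto
qed


section \<open>The upper bound\<close>

text \<open>Passing to an equivalence relation instead of the family of its classes makes products easy:
  the relation on a product holds iff it holds in each coordinate, and the classes need no
  indexing.\<close>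

definition separated_partition ::
    "'a metric \<Rightarrow> real \<Rightarrow> real \<Rightarrow> 'a set \<Rightarrow> ('a \<times> 'a) set \<Rightarrow> bool" where
  "separated_partition X s D A E \<longleftrightarrow> A \<subseteq> mspace X \<and> equiv A E \<and>
     (\<forall>x\<in>A. \<forall>y\<in>A. if (x, y) \<in> E then mdist X x y \<le> D else s < mdist X x y)"

lemma separated_partition_classes_eq:
  assumes "separated_partition X s D A E"
    and "P \<in> A // E" "Q \<in> A // E" "x \<in> P" "y \<in> Q" "mdist X x y \<le> s"
  shows "P = Q"
proof -
  have eq: "equiv A E" using assms(1) by (simp add: separated_partition_def)
  have "x \<in> A" "y \<in> A" using assms(2-5) eq in_quotient_imp_subset by blast+
  with assms(1,6) have "(x, y) \<in> E"
    unfolding separated_partition_def by (metis not_less)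
  with eq assms(2-5) show ?thesis
    by (simp add: quotient_eq_iff)
qed

text \<open>A set of diameter at most \<open>s\<close> meets at most one class of each of the
  \<open>n + 1\<close> colours. If different colours share a class, it counts once, which only helps.\<close>

lemma nagata_dim_le_of_separated_partitions:
  fixes X :: "'a metric"
  assumes "0 < c"
    and "\<And>s. 0 < s \<Longrightarrow> \<exists>A E. (\<forall>j\<le>n. separated_partition X s (c * s) (A j) (E j)) \<and>
                 mspace X \<subseteq> (\<Union>j\<le>n. A j)"
  shows "nagata_dim X \<le> ereal (real n)"
proof -
  have "\<exists>(I :: 'a set set) (B :: 'a set \<Rightarrow> 'a set).
         covering_family X I B \<and> bounded_family X (c * s) I B \<and>
         ereal_of_enat (multiplicity_at X s I B) \<le> ereal (real_of_int (int n + 1))"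
    if s: "0 < s" for s
  proof -
    obtain A E where AE: "\<And>j. j \<le> n \<Longrightarrow> separated_partition X s (c * s) (A j) (E j)"
      and cov: "mspace X \<subseteq> (\<Union>j\<le>n. A j)"
      using assms(2)[OF s] by blast
    have eq: "equiv (A j) (E j)" and sub: "A j \<subseteq> mspace X" if "j \<le> n" for j
      using AE[OF that] by (auto simp: separated_partition_def)
    define I where "I = (\<Union>j\<le>n. A j // E j)"
    have "\<Union>I = (\<Union>j\<le>n. \<Union>(A j // E j))"
      unfolding I_def by auto
    also have "\<dots> = (\<Union>j\<le>n. A j)"
      using Union_quotient[OF eq] by simp
    also have "\<dots> = mspace X"
      using cov sub by (intro antisym) auto
    finally have c1: "covering_family X I (\<lambda>P. P)"
      unfolding covering_family_def by auto
    have c2: "bounded_family X (c * s) I (\<lambda>P. P)"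
      unfolding bounded_family_def mdiam_le_iff
    proof (intro ballI)
      fix P x y assume "P \<in> I" and xy: "x \<in> P" "y \<in> P"
      then obtain j where j: "j \<le> n" "P \<in> A j // E j" by (auto simp: I_def)
      then have "x \<in> A j" "y \<in> A j" "(x, y) \<in> E j"
        using xy eq[OF j(1)] in_quotient_imp_subset quotient_eq_iff by fast+
      with AE[OF j(1)] show "mdist X x y \<le> c * s"
        unfolding separated_partition_def by metis
    qed
    have "multiplicity_at X s I (\<lambda>P. P) \<le> enat (n + 1)"
      unfolding multiplicity_at_le_iff
    proof (intro allI impI)
      fix S assume S: "\<forall>x\<in>S. \<forall>y\<in>S. mdist X x y \<le> s"
      define M where "M j = {P \<in> A j // E j. P \<inter> S \<noteq> {}}" for j
      have one: "finite (M j) \<and> card (M j) \<le> 1" if j: "j \<le> n" for j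
      proof -
        have "P = Q" if "P \<in> M j" "Q \<in> M j" for P Q
          using that S separated_partition_classes_eq[OF AE[OF j], of P Q]
          unfolding M_def by blast
        then have "\<exists>P. M j \<subseteq> {P}" by blast
        then show ?thesis
          by (metis card.empty card_1_singleton_iff finite.emptyI finite_insert le_numeral_extra(4)
              less_eq_nat.simps(1) subset_singletonD One_nat_def)
      qed
      have eqM: "{P \<in> I. P \<inter> S \<noteq> {}} = (\<Union>j\<le>n. M j)"
        by (auto simp: I_def M_def)
      have "card (\<Union>j\<le>n. M j) \<le> (\<Sum>j\<le>n. card (M j))"
        by (rule card_UN_le) simp
      also have "\<dots> \<le> (\<Sum>j\<le>n. 1)"
        using one by (intro sum_mono) auto
      finally show "finite {P \<in> I. P \<inter> S \<noteq> {}} \<and> card {P \<in> I. P \<inter> S \<noteq> {}} \<le> n + 1"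
        unfolding eqM using one by auto
    qed
    then have "ereal_of_enat (multiplicity_at X s I (\<lambda>P. P)) \<le> ereal_of_enat (enat (n + 1))"
      by (simp only: ereal_of_enat_le_iff)
    then have c3: "ereal_of_enat (multiplicity_at X s I (\<lambda>P. P)) \<le> ereal (real_of_int (int n + 1))"
      by (simp add: add.commute)
    show ?thesis using c1 c2 c3 by blast
  qed
  then have "ereal (real_of_int (int n)) \<in> {ereal (real_of_int m) | m :: int.
       \<exists>c>0. \<forall>s>0. \<exists>(I :: 'a set set) (B :: 'a set \<Rightarrow> 'a set).
         covering_family X I B \<and> bounded_family X (c * s) I B \<and>
         ereal_of_enat (multiplicity_at X s I B) \<le> ereal (real_of_int (m + 1))}"
    using \<open>0 < c\<close> by blast
  then show ?thesis
    unfolding nagata_dim_def by (metis (no_types, lifting) Inf_lower of_int_of_nat_eq)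
qed

text \<open>Inequivalent points are already far apart in one coordinate, and equivalent ones are close in
  every coordinate; the \<open>l\<^sup>2\<close> distance lies between the maximum and the sum of the
  coordinate distances.\<close>

lemma separated_partition_l2_product:
  assumes I: "finite I" and "0 \<le> D"
    and sp: "\<And>i. i \<in> I \<Longrightarrow> separated_partition (T i) s D (A i) (E i)"
  shows "separated_partition (l2_product I T) s (real (card I) * D) (\<Pi>\<^sub>E i\<in>I. A i)
           {(x, y). x \<in> (\<Pi>\<^sub>E i\<in>I. A i) \<and> y \<in> (\<Pi>\<^sub>E i\<in>I. A i) \<and> (\<forall>i\<in>I. (x i, y i) \<in> E i)}"
    (is "separated_partition _ _ _ ?A ?E")
  unfolding separated_partition_def
proof (intro conjI ballI)
  have eq: "equiv (A i) (E i)" and sub: "A i \<subseteq> mspace (T i)" if "i \<in> I" for i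
    using sp[OF that] by (auto simp: separated_partition_def)
  show "?A \<subseteq> mspace (l2_product I T)"
    unfolding mspace_l2_product[OF I] using sub by (intro PiE_mono) auto
  show "equiv ?A ?E"
  proof (rule equivI)
    show "?E \<subseteq> ?A \<times> ?A" by auto
    show "refl_on ?A ?E"
      using eq by (auto simp: refl_on_def equiv_def PiE_mem)
    show "sym ?E"
      using eq by (auto simp: sym_def equiv_def)
    show "trans ?E"
    proof (rule transI)
      fix x y z assume "(x, y) \<in> ?E" "(y, z) \<in> ?E"
      then show "(x, z) \<in> ?E"
        using eq by (auto simp: equiv_def intro: transD)
    qed
  qed
  fix x y assume x: "x \<in> ?A" and y: "y \<in> ?A"
  let ?d = "\<lambda>i. mdist (T i) (x i) (y i)"
  show "if (x, y) \<in> ?E then mdist (l2_product I T) x y \<le> real (card I) * D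
        else s < mdist (l2_product I T) x y"
  proof (cases "(x, y) \<in> ?E")
    case True
    have "?d i \<le> D" if "i \<in> I" for i
      using sp[OF that] True that unfolding separated_partition_def
      by (smt (verit) PiE_mem case_prodD mem_Collect_eq)
    then have "L2_set ?d I \<le> real (card I) * D"
      by (intro order_trans[OF L2_set_le_sum] sum_bounded_above) auto
    with True show ?thesis by (simp add: mdist_l2_product[OF I])
  next
    case False
    then obtain i where i: "i \<in> I" "(x i, y i) \<notin> E i" using x y by auto
    have "s < ?d i"
      using sp[OF i(1)] i x y unfolding separated_partition_def by (metis PiE_mem)
    also have "\<dots> \<le> L2_set ?d I"
      using I i(1) by (rule member_le_L2_set)
    finally show ?thesis
      unfolding if_not_P[OF False] mdist_l2_product[OF I] .
  qed
qed

definition gromov_product :: "'a metric \<Rightarrow> 'a \<Rightarrow> 'a \<Rightarrow> 'a \<Rightarrow> real" where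
  "gromov_product X p x y = (mdist X p x + mdist X p y - mdist X x y) / 2"

lemma geodesic_segment_sym:
  assumes "geodesic_segment X x y S"
  shows "geodesic_segment X y x S"
proof -
  let ?D = "mdist X x y"
  obtain g where g: "g ` {0..?D} = S" "S \<subseteq> mspace X" "g 0 = x" "g ?D = y"
    "\<forall>t\<in>{0..?D}. \<forall>u\<in>{0..?D}. mdist X (g t) (g u) = \<bar>t - u\<bar>"
    using assms unfolding geodesic_segment_def by blast
  have "(\<lambda>t. ?D - t) ` {0..?D} = {0..?D}" by simp
  then have "(\<lambda>t. g (?D - t)) ` {0..?D} = S"
    by (metis g(1) image_image)
  with g show ?thesis
    unfolding geodesic_segment_def mdist_commute[of X y x]
    by (intro exI[of _ "\<lambda>t. g (?D - t)"]) auto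
qed

text \<open>In a degenerate triangle with vertices \<open>p\<close>, \<open>x\<close>, \<open>y\<close>, the
  point of \<open>[p, x]\<close> at distance \<open>t\<close> from \<open>p\<close> lies on \<open>[p, y]\<close> or
  on \<open>[x, y]\<close>. In the second case the triangle inequality for \<open>p\<close>, this point and
  \<open>y\<close> forces \<open>t\<close> to be at least the Gromov product; in the first case the point of
  \<open>[p, y]\<close> is determined by its distance from \<open>p\<close>.\<close>

lemma metric_tree_geodesics_agree:
  assumes tree: "metric_tree X"
    and p: "p \<in> mspace X" and x: "x \<in> mspace X" and y: "y \<in> mspace X"
    and g: "g ` {0..mdist X p x} \<subseteq> mspace X" "g 0 = p" "g (mdist X p x) = x"
      "\<forall>t\<in>{0..mdist X p x}. \<forall>u\<in>{0..mdist X p x}. mdist X (g t) (g u) = \<bar>t - u\<bar>"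
    and h: "h ` {0..mdist X p y} \<subseteq> mspace X" "h 0 = p" "h (mdist X p y) = y"
      "\<forall>t\<in>{0..mdist X p y}. \<forall>u\<in>{0..mdist X p y}. mdist X (h t) (h u) = \<bar>t - u\<bar>"
    and t: "0 \<le> t" "t < gromov_product X p x y"
  shows "g t = h t"
proof -
  have P: "geodesic_segment X p x (g ` {0..mdist X p x})"
    unfolding geodesic_segment_def using g by blast
  have R: "geodesic_segment X y p (h ` {0..mdist X p y})"
    by (rule geodesic_segment_sym) (use h in \<open>auto simp: geodesic_segment_def\<close>)
  obtain Q where Q: "geodesic_segment X x y Q"
    using tree x y unfolding metric_tree_def geodesic_space_def by blast
  have sub: "g ` {0..mdist X p x} \<subseteq> Q \<union> h ` {0..mdist X p y}"
    using tree P Q R p x y unfolding metric_tree_def geodesic_triangle_def by blast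
  have "mdist X p y \<le> mdist X p x + mdist X x y"
    using mdist_triangle[OF p x y] .
  then have tx: "t \<le> mdist X p x"
    using t by (simp add: gromov_product_def)
  have dpt: "mdist X p (g t) = t"
    using g(2) g(4)[rule_format, of 0 t] t(1) tx by auto
  have dtx: "mdist X (g t) x = mdist X p x - t"
    using g(3) g(4)[rule_format, of t "mdist X p x"] t(1) tx by auto
  have gt: "g t \<in> mspace X" using g(1) t(1) tx by auto
  have "g t \<notin> Q"
  proof
    assume "g t \<in> Q"
    then obtain k u where k: "k 0 = x" "k (mdist X x y) = y" "u \<in> {0..mdist X x y}" "g t = k u"
      "\<forall>t\<in>{0..mdist X x y}. \<forall>u\<in>{0..mdist X x y}. mdist X (k t) (k u) = \<bar>t - u\<bar>"
      using Q unfolding geodesic_segment_def by blast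
    have "mdist X x (g t) = u" "mdist X (g t) y = mdist X x y - u"
      using k(5)[rule_format, of 0 u] k(5)[rule_format, of u "mdist X x y"] k(1-4) by auto
    then have "mdist X (g t) y = mdist X x y - (mdist X p x - t)"
      using dtx by (simp add: mdist_commute)
    moreover have "mdist X p y \<le> t + mdist X (g t) y"
      using mdist_triangle[OF p gt y] dpt by simp
    ultimately show False
      using t(2) by (simp add: gromov_product_def)
  qed
  moreover have "g t \<in> g ` {0..mdist X p x}"
    using t(1) tx by simp
  ultimately obtain u where u: "u \<in> {0..mdist X p y}" "g t = h u"
    using sub by blast
  then have "mdist X p (g t) = u"
    using h(2) h(4)[rule_format, of 0 u] by auto
  with u dpt show ?thesis by simp
qed

text \<open>Up to any height \<open>t\<close> below both Gromov products on the left, the geodesics to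
  \<open>x\<close>, \<open>y\<close> and \<open>z\<close> coincide; a path from \<open>x\<close> to \<open>z\<close>
  through their common point at height \<open>t\<close> shows that the Gromov product on the right is
  at least \<open>t\<close>.\<close>

lemma metric_tree_gromov_product:
  assumes tree: "metric_tree X"
    and p: "p \<in> mspace X" and x: "x \<in> mspace X" and y: "y \<in> mspace X" and z: "z \<in> mspace X"
  shows "min (gromov_product X p x y) (gromov_product X p y z) \<le> gromov_product X p x z"
proof (rule ccontr)
  assume "\<not> ?thesis"
  then obtain t where t: "gromov_product X p x z < t" "t < gromov_product X p x y"
      "t < gromov_product X p y z"
    using dense[of "gromov_product X p x z"
        "min (gromov_product X p x y) (gromov_product X p y z)"]
    by (metis min_less_iff_conj not_le)
  have "mdist X x z \<le> mdist X x p + mdist X p z"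
    using mdist_triangle[OF x p z] .
  then have t0: "0 \<le> t"
    using t(1) by (simp add: gromov_product_def mdist_commute)
  have "\<exists>g. g ` {0..mdist X p w} \<subseteq> mspace X \<and> g 0 = p \<and> g (mdist X p w) = w \<and>
      (\<forall>t\<in>{0..mdist X p w}. \<forall>u\<in>{0..mdist X p w}. mdist X (g t) (g u) = \<bar>t - u\<bar>)"
    if w: "w \<in> mspace X" for w
    using tree p w unfolding metric_tree_def geodesic_space_def geodesic_segment_def by metis
  then obtain g where g: "\<And>w. w \<in> mspace X \<Longrightarrow> g w ` {0..mdist X p w} \<subseteq> mspace X"
      "\<And>w. w \<in> mspace X \<Longrightarrow> g w 0 = p" "\<And>w. w \<in> mspace X \<Longrightarrow> g w (mdist X p w) = w"
      "\<And>w. w \<in> mspace X \<Longrightarrow> \<forall>t\<in>{0..mdist X p w}. \<forall>u\<in>{0..mdist X p w}.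
          mdist X (g w t) (g w u) = \<bar>t - u\<bar>"
    by metis
  have "g x t = g y t"
    by (rule metric_tree_geodesics_agree[OF tree p x y g[OF x] g[OF y] t0 t(2)])
  also have "\<dots> = g z t"
    by (rule metric_tree_geodesics_agree[OF tree p y z g[OF y] g[OF z] t0 t(3)])
  finally have xz: "g x t = g z t" .
  have "mdist X p y \<le> mdist X p x + mdist X x y" "mdist X p y \<le> mdist X p z + mdist X z y"
    using mdist_triangle[OF p x y] mdist_triangle[OF p z y] .
  then have tx: "t \<le> mdist X p x" and tz: "t \<le> mdist X p z"
    using t(2,3) by (auto simp: gromov_product_def mdist_commute)
  have "mdist X x (g x t) = mdist X p x - t"
    using g(3)[OF x] g(4)[OF x, rule_format, of "mdist X p x" t] t0 tx by auto
  moreover have "mdist X (g z t) z = mdist X p z - t"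
    using g(3)[OF z] g(4)[OF z, rule_format, of t "mdist X p z"] t0 tz by auto
  moreover have "g x t \<in> mspace X"
    using g(1)[OF x] t0 tx by auto
  ultimately have "mdist X x z \<le> (mdist X p x - t) + (mdist X p z - t)"
    using mdist_triangle[OF x _ z] xz by metis
  then show False using t(1) by (simp add: gromov_product_def)
qed

text \<open>The \<open>n + 1\<close> colours are arranged so that each point is missed by a single one of them:
  the surplus over the two colours that suffice for one tree is what makes a common colour
  available in a product.\<close>

lemma metric_tree_separated_partitions:
  assumes tree: "metric_tree X" and p: "p \<in> mspace X" and s: "0 < s"
  obtains A E where
    "\<And>j. j \<le> n \<Longrightarrow> separated_partition X s ((2 * real n + 1) * s) (A j) (E j)"
    "\<And>x. x \<in> mspace X \<Longrightarrow> \<exists>k. \<forall>j\<le>n. j \<noteq> k \<longrightarrow> x \<in> A j"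
proof -
  (* q is the number of the slice. Colour j omits the slices congruent to j modulo n + 1, m numbers
     the annuli between them, and a is the lower radius of the annulus that contains x. *)
  define q where "q x = \<lfloor>mdist X p x / s\<rfloor>" for x
  define A where "A j = {x \<in> mspace X. (q x - int j) mod (int n + 1) \<noteq> 0}" for j
  define m where "m j x = (q x - int j) div (int n + 1)" for j x
  define a where "a j x = s * of_int (int j + m j x * (int n + 1) + 1)" for j x
  (* The margin s / 2 below the annulus makes inequivalent points of one annulus more than s apart,
     since each of them has to descend by more than s / 2 to reach the other. *)
  define E where "E j = {(x, y). x \<in> A j \<and> y \<in> A j \<and> m j x = m j y \<and>
      a j x - s / 2 \<le> gromov_product X p x y}" for j
  have qle: "s * of_int (q x) \<le> mdist X p x" for x
  proof -
    have "of_int (q x) \<le> mdist X p x / s" by (simp add: q_def)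
    then show ?thesis using s by (simp add: pos_le_divide_eq mult.commute)
  qed
  have qgt: "mdist X p x < s * (of_int (q x) + 1)" for x
  proof -
    have "mdist X p x / s < of_int (q x) + 1" by (simp add: q_def)
    then show ?thesis using s by (simp add: pos_divide_less_eq mult.commute)
  qed
  have qA: "int j + m j x * (int n + 1) + 1 \<le> q x \<and> q x \<le> int j + m j x * (int n + 1) + int n"
    if "x \<in> A j" for j x
  proof -
    have "q x - int j = m j x * (int n + 1) + (q x - int j) mod (int n + 1)"
      unfolding m_def by (rule div_mult_mod_eq[symmetric])
    moreover have "0 \<le> (q x - int j) mod (int n + 1)" "(q x - int j) mod (int n + 1) < int n + 1"
      by (simp_all only: pos_mod_sign pos_mod_bound of_nat_0_le_iff add_nonneg_pos zero_less_one)
    moreover have "(q x - int j) mod (int n + 1) \<noteq> 0"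
      using that by (simp add: A_def)
    ultimately show ?thesis by linarith
  qed
  have lower: "a j x \<le> mdist X p x" if "x \<in> A j" for j x
  proof -
    have "a j x \<le> s * of_int (q x)"
      unfolding a_def using qA[OF that] s by (intro mult_left_mono) (simp_all only: of_int_le_iff less_imp_le)
    with qle[of x] show ?thesis by linarith
  qed
  have upper: "mdist X p x \<le> a j x + real n * s" if "x \<in> A j" for j x
  proof -
    have "s * of_int (q x + 1) \<le> s * of_int (int j + m j x * (int n + 1) + 1 + int n)"
      using qA[OF that] s by (intro mult_left_mono) (simp_all only: of_int_le_iff less_imp_le, linarith)
    also have "\<dots> = a j x + real n * s"
      by (simp add: a_def algebra_simps)
    finally show ?thesis using qgt[of x] by simp
  qed
  have gap: "s < mdist X x y" if "x \<in> A j" "y \<in> A j" "m j x < m j y" for j x y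
  proof -
    have "m j x * (int n + 1) + (int n + 1) \<le> m j y * (int n + 1)"
      using mult_right_mono[of "m j x + 1" "m j y" "int n + 1"] that(3) by (simp add: algebra_simps)
    then have "q x + 2 \<le> q y"
      using qA[OF that(1)] qA[OF that(2)] by linarith
    then have "s * of_int (q x + 2) \<le> s * of_int (q y)"
      using s by (intro mult_left_mono) (simp_all only: of_int_le_iff less_imp_le)
    then have "mdist X p x + s < mdist X p y"
      using qgt[of x] qle[of y] by (simp add: algebra_simps)
    moreover have "mdist X p y \<le> mdist X p x + mdist X x y"
      using that by (intro mdist_triangle p) (auto simp: A_def)
    ultimately show ?thesis by simp
  qed
  have am: "a j x = a j y" if "m j x = m j y" for j x y
    using that by (simp add: a_def)
  show thesis
  proof (rule that)
    fix j
    have refl: "a j x - s / 2 \<le> gromov_product X p x x" if "x \<in> A j" for x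
    proof -
      have "mdist X x x = 0" using that by (simp add: A_def)
      with lower[OF that] s show ?thesis by (simp add: gromov_product_def)
    qed
    have "equiv (A j) (E j)"
    proof (rule equivI)
      show "E j \<subseteq> A j \<times> A j" by (auto simp: E_def)
      show "refl_on (A j) (E j)"
        unfolding refl_on_def E_def using refl by auto
      show "sym (E j)"
        unfolding sym_def E_def gromov_product_def
        by (auto simp: mdist_commute add.commute dest: am)
      show "trans (E j)"
      proof (rule transI)
        fix x y z assume xy: "(x, y) \<in> E j" and yz: "(y, z) \<in> E j"
        then have "min (gromov_product X p x y) (gromov_product X p y z) \<le> gromov_product X p x z"
          by (intro metric_tree_gromov_product tree p) (auto simp: E_def A_def)
        moreover have "a j x = a j y" using xy by (intro am) (simp add: E_def)
        ultimately show "(x, z) \<in> E j"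
          using xy yz by (auto simp: E_def)
      qed
    qed
    moreover have "if (x, y) \<in> E j then mdist X x y \<le> (2 * real n + 1) * s else s < mdist X x y"
      if x: "x \<in> A j" and y: "y \<in> A j" for x y
    proof (cases "m j x = m j y")
      case False
      then have "s < mdist X x y"
        using gap[OF x y] gap[OF y x] by (metis linorder_neqE mdist_commute)
      with False show ?thesis by (simp add: E_def)
    next
      case True
      have d: "mdist X x y = mdist X p x + mdist X p y - 2 * gromov_product X p x y"
        unfolding gromov_product_def by argo
      have iff: "(x, y) \<in> E j \<longleftrightarrow> a j x - s / 2 \<le> gromov_product X p x y"
        using True x y by (simp add: E_def)
      show ?thesis
      proof (cases "(x, y) \<in> E j")
        case E: True
        have "mdist X x y \<le> 2 * (real n * s) + s"
          using E[unfolded iff] d upper[OF x] upper[OF y] am[OF True] by linarith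
        with E show ?thesis by (simp add: algebra_simps)
      next
        case E: False
        have "s < mdist X x y"
          using E[unfolded iff] d lower[OF x] lower[OF y] am[OF True] by linarith
        with E show ?thesis by simp
      qed
    qed
    ultimately show "separated_partition X s ((2 * real n + 1) * s) (A j) (E j)"
      unfolding separated_partition_def by (auto simp: A_def)
  next
    fix x assume x: "x \<in> mspace X"
    have "x \<in> A j" if "j \<le> n" "j \<noteq> nat (q x mod (int n + 1))" for j
    proof -
      have "(q x - int j) mod (int n + 1) \<noteq> 0"
      proof
        assume "(q x - int j) mod (int n + 1) = 0"
        then have "q x mod (int n + 1) = int j mod (int n + 1)"
          unfolding mod_eq_dvd_iff by (rule mod_0_imp_dvd)
        also have "\<dots> = int j" using that(1) by simp
        finally show False using that(2) by simp
      qed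
      with x show ?thesis by (simp only: A_def mem_Collect_eq simp_thms)
    qed
    then show "\<exists>k. \<forall>j\<le>n. j \<noteq> k \<longrightarrow> x \<in> A j" by blast
  qed
qed

text \<open>Each of the \<open>card I\<close> coordinates of a point rules out at most one of the
  \<open>card I + 1\<close> colours, so by counting one colour is left.\<close>

lemma nagata_dim_l2_product_trees_le:
  assumes I: "finite I" and tree: "\<And>i. i \<in> I \<Longrightarrow> metric_tree (T i)"
    and ne: "\<And>i. i \<in> I \<Longrightarrow> mspace (T i) \<noteq> {}"
  shows "nagata_dim (l2_product I T) \<le> ereal (real (card I))"
proof (rule nagata_dim_le_of_separated_partitions)
  let ?n = "card I"
  (* The summand 1 keeps the constant positive when there are no factors. *)
  let ?c = "real ?n * (2 * real ?n + 1) + 1"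
  show "0 < ?c" by (simp add: add_nonneg_pos)
  fix s :: real assume s: "0 < s"
  have "\<exists>A E. (\<forall>j\<le>?n. separated_partition (T i) s ((2 * real ?n + 1) * s) (A j) (E j)) \<and>
      (\<forall>x\<in>mspace (T i). \<exists>k. \<forall>j\<le>?n. j \<noteq> k \<longrightarrow> x \<in> A j)" if "i \<in> I" for i
    using metric_tree_separated_partitions[OF tree[OF that] _ s, of _ ?n] ne[OF that]
    by (metis ex_in_conv)
  then obtain A E where
    sp: "\<And>i j. i \<in> I \<Longrightarrow> j \<le> ?n \<Longrightarrow>
          separated_partition (T i) s ((2 * real ?n + 1) * s) (A i j) (E i j)" and
    miss: "\<And>i x. i \<in> I \<Longrightarrow> x \<in> mspace (T i) \<Longrightarrow> \<exists>k. \<forall>j\<le>?n. j \<noteq> k \<longrightarrow> x \<in> A i j"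
    by metis
  define A' where "A' j = (\<Pi>\<^sub>E i\<in>I. A i j)" for j
  define E' where "E' j = {(x, y). x \<in> A' j \<and> y \<in> A' j \<and> (\<forall>i\<in>I. (x i, y i) \<in> E i j)}" for j
  have "separated_partition (l2_product I T) s (?c * s) (A' j) (E' j)" if j: "j \<le> ?n" for j
  proof -
    have "separated_partition (l2_product I T) s (real ?n * ((2 * real ?n + 1) * s)) (A' j) (E' j)"
      unfolding A'_def E'_def using s sp j
      by (intro separated_partition_l2_product I) auto
    moreover have "real ?n * ((2 * real ?n + 1) * s) \<le> ?c * s"
      using s by (simp add: algebra_simps)
    ultimately show ?thesis
      unfolding separated_partition_def by (smt (verit))
  qed
  moreover have "mspace (l2_product I T) \<subseteq> (\<Union>j\<le>?n. A' j)"
  proof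
    fix x assume x: "x \<in> mspace (l2_product I T)"
    then have x': "x \<in> (\<Pi>\<^sub>E i\<in>I. mspace (T i))" by (simp add: mspace_l2_product[OF I])
    obtain k where k: "\<And>i j. i \<in> I \<Longrightarrow> j \<le> ?n \<Longrightarrow> j \<noteq> k i \<Longrightarrow> x i \<in> A i j"
      using miss[OF _ PiE_mem[OF x']] by metis
    have "card (k ` I) < card {..?n}"
      using card_image_le[OF I, of k] by simp
    then have "\<not> {..?n} \<subseteq> k ` I"
      using card_mono[of "k ` I" "{..?n}"] I by auto
    then obtain j where "j \<le> ?n" "j \<notin> k ` I" by auto
    then have "x \<in> A' j"
      unfolding A'_def using k x' by (auto simp: PiE_iff)
    with \<open>j \<le> ?n\<close> show "x \<in> (\<Union>j\<le>?n. A' j)" by auto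
  qed
  ultimately show "\<exists>A E. (\<forall>j\<le>?n. separated_partition (l2_product I T) s (?c * s) (A j) (E j)) \<and>
      mspace (l2_product I T) \<subseteq> (\<Union>j\<le>?n. A j)"
    by blast
qed


section \<open>The lower bound\<close>

text \<open>Kuhn's combinatorial lemma labels grid points by vectors of zeros and ones, with zeros on the
  lower faces and ones on the upper faces. Since no colour occurs on two opposite faces, such a label
  can be computed from the colour alone, so that the \<open>n + 1\<close> reduced labels occurring in one
  simplex come from \<open>n + 1\<close> colours.\<close>

lemma grid_colouring_rainbow_simplex:
  fixes c :: "(nat \<Rightarrow> nat) \<Rightarrow> 'i"
  assumes p: "0 < p"
    and opp: "\<And>x y j. j < n \<Longrightarrow> \<forall>i. x i \<le> p \<Longrightarrow> \<forall>i. y i \<le> p \<Longrightarrow> x j = 0 \<Longrightarrow> y j = p \<Longrightarrow> c x \<noteq> c y"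
  obtains \<sigma> where "finite \<sigma>" "\<And>x i. x \<in> \<sigma> \<Longrightarrow> x i \<le> p"
    "\<And>x y j. x \<in> \<sigma> \<Longrightarrow> y \<in> \<sigma> \<Longrightarrow> j < n \<Longrightarrow> x j \<le> y j + 1" "n < card (c ` \<sigma>)"
proof -
  (* The j-th entry of the label tells whether the colour k occurs on the upper face j. *)
  define \<phi> where "\<phi> k j = (if \<exists>y. (\<forall>i. y i \<le> p) \<and> y j = p \<and> c y = k then 1 else 0 :: nat)" for k j
  have "odd (card {s. ksimplex p n s \<and> (reduced n \<circ> (\<lambda>x. \<phi> (c x))) ` s = {..n}})"
  proof (rule kuhn_combinatorial[OF p]; intro allI impI; elim conjE)
    fix x :: "nat \<Rightarrow> nat" and j assume x: "\<forall>i. x i \<le> p" "j < n"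
    show "\<phi> (c x) j = 0" if "x j = 0"
      using opp[OF x(2,1) _ that] unfolding \<phi>_def by metis
    show "\<phi> (c x) j = 1" if "x j = p"
      using x that unfolding \<phi>_def by auto
  qed
  then obtain \<sigma> where "ksimplex p n \<sigma>" and full: "(reduced n \<circ> (\<lambda>x. \<phi> (c x))) ` \<sigma> = {..n}"
    using odd_card_imp_not_empty by blast
  then obtain b u where "kuhn_simplex p n b u \<sigma>"
    by (auto elim: ksimplex.cases)
  then interpret kuhn_simplex p n b u \<sigma> .
  have fin: "finite \<sigma>" by (simp add: s_eq)
  have "{..n} = (\<lambda>k. reduced n (\<phi> k)) ` (c ` \<sigma>)"
    using full by (auto simp: image_image)
  then have "card {..n} \<le> card (c ` \<sigma>)"
    by (metis card_image_le fin finite_imageI)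
  then have card: "n < card (c ` \<sigma>)" by simp
  show thesis
  proof (rule that[OF fin _ _ card])
    fix x i assume x: "x \<in> \<sigma>"
    show "x i \<le> p"
      using s_space x out_eq_p[OF x, of i] by (cases "i < n") auto
  next
    fix x y j assume "x \<in> \<sigma>" "y \<in> \<sigma>" "j < n"
    then show "x j \<le> y j + 1"
      using le_Suc_base[of x j] base_le[of y j] by simp
  qed
qed

text \<open>A function \<open>e\<close> on \<open>[0, l]\<^sup>n\<close> is encoded on sequences, of which only the first
  \<open>n\<close> entries matter for distances. It need only be sandwiched between the maximum and the sum
  metric: the lower estimate keeps opposite faces \<open>l\<close> apart, the upper one makes the mesh of
  the grid small.\<close>

lemma nagata_dim_ge_of_cube:
  fixes X :: "'a metric" and e :: "(nat \<Rightarrow> real) \<Rightarrow> 'a"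
  assumes l: "0 < l"
    and e: "\<And>x. \<forall>j. x j \<in> {0..l} \<Longrightarrow> e x \<in> mspace X"
    and le: "\<And>x y. \<forall>j. x j \<in> {0..l} \<Longrightarrow> \<forall>j. y j \<in> {0..l} \<Longrightarrow>
               mdist X (e x) (e y) \<le> (\<Sum>j<n. \<bar>x j - y j\<bar>)"
    and ge: "\<And>x y j. \<forall>j. x j \<in> {0..l} \<Longrightarrow> \<forall>j. y j \<in> {0..l} \<Longrightarrow> j < n \<Longrightarrow>
               \<bar>x j - y j\<bar> \<le> mdist X (e x) (e y)"
  shows "ereal (real n) \<le> nagata_dim X"
  unfolding nagata_dim_def
proof (rule Inf_greatest, clarify)
  fix m :: int and c :: real
  assume c: "0 < c" and H: "\<forall>s>0. \<exists>(I :: 'a set set) (B :: 'a set \<Rightarrow> 'a set).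
         covering_family X I B \<and> bounded_family X (c * s) I B \<and>
         ereal_of_enat (multiplicity_at X s I B) \<le> ereal (real_of_int (m + 1))"
  show "ereal (real n) \<le> ereal (real_of_int m)"
  proof (rule ccontr)
    assume "\<not> ?thesis"
    then have "m < int n" by simp
    (* At this scale the members have diameter at most l / 2, less than the distance of opposite
       faces. *)
    define s where "s = l / (2 * c)"
    have s: "0 < s" using l c by (simp add: s_def)
    obtain I :: "'a set set" and B :: "'a set \<Rightarrow> 'a set" where cov: "covering_family X I B"
      and bd: "bounded_family X (c * s) I B"
      and mu: "ereal_of_enat (multiplicity_at X s I B) \<le> ereal (real_of_int (m + 1))"
      using H s by blast
    have "ereal (real_of_int (m + 1)) \<le> ereal_of_enat (enat n)"
      using \<open>m < int n\<close> by simp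
    with mu have "ereal_of_enat (multiplicity_at X s I B) \<le> ereal_of_enat (enat n)"
      by (rule order_trans)
    then have mult: "multiplicity_at X s I B \<le> enat n"
      by (simp only: ereal_of_enat_le_iff)
    obtain p0 where p0: "real n * l / s < real p0"
      using reals_Archimedean2 by blast
    define p where "p = Suc p0"
    have p: "0 < p" and mesh: "real n * (l / real p) \<le> s"
      using p0 s by (auto simp: p_def field_simps)
    define G where "G x = (\<lambda>j. l * real (x j) / real p)" for x :: "nat \<Rightarrow> nat"
    have G: "\<forall>j. G x j \<in> {0..l}" if "\<forall>i. x i \<le> p" for x
      using that p l by (auto simp: G_def field_simps)
    have "\<exists>k\<in>I. e (G x) \<in> B k" if "\<forall>i. x i \<le> p" for x
      using e[OF G[OF that]] cov unfolding covering_family_def by blast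
    then obtain k where k: "\<And>x. \<forall>i. x i \<le> p \<Longrightarrow> k x \<in> I"
      "\<And>x. \<forall>i. x i \<le> p \<Longrightarrow> e (G x) \<in> B (k x)"
      by metis
    have "k x \<noteq> k y" if j: "j < n" "\<forall>i. x i \<le> p" "\<forall>i. y i \<le> p" "x j = 0" "y j = p" for x y j
    proof
      assume "k x = k y"
      then have "mdist X (e (G x)) (e (G y)) \<le> c * s"
        using bd k[OF j(2)] k[OF j(3)] unfolding bounded_family_def mdiam_le_iff by metis
      also have "\<dots> < l" using c l by (simp add: s_def)
      finally have "mdist X (e (G x)) (e (G y)) < l" .
      moreover have "\<bar>G x j - G y j\<bar> = l"
        using j(4,5) p l by (simp add: G_def)
      ultimately show False
        using ge[OF G[OF j(2)] G[OF j(3)] j(1)] by simp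
    qed
    then obtain \<sigma> where \<sigma>: "finite \<sigma>" "\<And>x i. x \<in> \<sigma> \<Longrightarrow> x i \<le> p"
      "\<And>x y j. x \<in> \<sigma> \<Longrightarrow> y \<in> \<sigma> \<Longrightarrow> j < n \<Longrightarrow> x j \<le> y j + 1" "n < card (k ` \<sigma>)"
      using grid_colouring_rainbow_simplex[OF p, of n k] by metis
    define S where "S = (\<lambda>x. e (G x)) ` \<sigma>"
    have "S \<subseteq> mspace X"
      unfolding S_def using e[OF G] \<sigma>(2) by auto
    moreover have "mdist X a b \<le> s" if ab: "a \<in> S" "b \<in> S" for a b
    proof -
      obtain x y where xy: "x \<in> \<sigma>" "y \<in> \<sigma>" "a = e (G x)" "b = e (G y)"
        using ab unfolding S_def by blast
      have "mdist X a b \<le> (\<Sum>j<n. \<bar>G x j - G y j\<bar>)"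
        unfolding xy using \<sigma>(2) xy(1,2) by (intro le G) auto
      also have "\<dots> \<le> (\<Sum>j<n. l / real p)"
      proof (rule sum_mono)
        fix j assume "j \<in> {..<n}"
        then have "\<bar>real (x j) - real (y j)\<bar> \<le> 1"
          using \<sigma>(3)[OF xy(1,2), of j] \<sigma>(3)[OF xy(2,1), of j] by auto
        moreover have "\<bar>G x j - G y j\<bar> = l / real p * \<bar>real (x j) - real (y j)\<bar>"
          using l by (simp add: G_def abs_mult flip: diff_divide_distrib right_diff_distrib)
        ultimately show "\<bar>G x j - G y j\<bar> \<le> l / real p"
          using l by (simp add: mult_left_le divide_right_mono)
      qed
      also have "\<dots> \<le> s" using mesh by simp
      finally show ?thesis .
    qed
    ultimately have "finite {i\<in>I. B i \<inter> S \<noteq> {}}" "card {i\<in>I. B i \<inter> S \<noteq> {}} \<le> n"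
      using mult unfolding multiplicity_at_le_iff by blast+
    moreover have "k ` \<sigma> \<subseteq> {i\<in>I. B i \<inter> S \<noteq> {}}"
      using k \<sigma>(2) unfolding S_def by blast
    ultimately have "card (k ` \<sigma>) \<le> n"
      by (meson card_mono order_trans)
    with \<sigma>(4) show False by simp
  qed
qed

text \<open>A geodesic between two distinct points in each factor, cut down to the common length
  \<open>l\<close>, embeds a cube isometrically. The factors are numbered from 1 and the coordinates of the
  cube from 0, whence the shift by one.\<close>

lemma nagata_dim_l2_product_geodesic_ge:
  fixes T :: "nat \<Rightarrow> 'a metric"
  assumes geo: "\<And>i. i \<in> {1..n} \<Longrightarrow> geodesic_space (T i)"
    and two: "\<And>i. i \<in> {1..n} \<Longrightarrow> \<exists>x\<in>mspace (T i). \<exists>y\<in>mspace (T i). x \<noteq> y"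
  shows "ereal (real n) \<le> nagata_dim (l2_product {1..n} T)"
proof -
  have "\<exists>d>0. \<exists>g. g ` {0..d} \<subseteq> mspace (T i) \<and>
      (\<forall>t\<in>{0..d}. \<forall>u\<in>{0..d}. mdist (T i) (g t) (g u) = \<bar>t - u\<bar>)" if i: "i \<in> {1..n}" for i
  proof -
    obtain x y where xy: "x \<in> mspace (T i)" "y \<in> mspace (T i)" "x \<noteq> y" using two[OF i] by blast
    then have "0 < mdist (T i) x y"
      using mdist_zero[of x "T i" y] mdist_nonneg[of "T i" x y] by linarith
    moreover obtain S where "geodesic_segment (T i) x y S"
      using geo[OF i] xy unfolding geodesic_space_def by blast
    ultimately show ?thesis
      unfolding geodesic_segment_def by metis
  qed
  then obtain d g where d: "\<And>i. i \<in> {1..n} \<Longrightarrow> 0 < d i"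
    and g: "\<And>i. i \<in> {1..n} \<Longrightarrow> g i ` {0..d i} \<subseteq> mspace (T i)"
    and iso: "\<And>i. i \<in> {1..n} \<Longrightarrow>
        \<forall>t\<in>{0..d i}. \<forall>u\<in>{0..d i}. mdist (T i) (g i t) (g i u) = \<bar>t - u\<bar>"
    by metis
  define l where "l = Min (insert 1 (d ` {1..n}))"
  have l: "0 < l" using d by (simp add: l_def)
  have ld: "l \<le> d i" if "i \<in> {1..n}" for i
    unfolding l_def using that by (intro Min_le) auto
  define e where "e x = (\<lambda>i\<in>{1..n}. g i (x (i - 1)))" for x :: "nat \<Rightarrow> real"
  have dist: "mdist (l2_product {1..n} T) (e x) (e y) = L2_set (\<lambda>i. \<bar>x (i - 1) - y (i - 1)\<bar>) {1..n}"
    if x: "\<forall>j. x j \<in> {0..l}" and y: "\<forall>j. y j \<in> {0..l}" for x y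
    unfolding mdist_l2_product[OF finite_atLeastAtMost]
  proof (rule L2_set_cong[OF refl])
    fix i assume i: "i \<in> {1..n}"
    have "x (i - 1) \<in> {0..d i}" "y (i - 1) \<in> {0..d i}"
      using x y ld[OF i] by (meson atLeastAtMost_iff order_trans)+
    with iso[OF i] show "mdist (T i) (e x i) (e y i) = \<bar>x (i - 1) - y (i - 1)\<bar>"
      using i by (simp add: e_def)
  qed
  show ?thesis
  proof (rule nagata_dim_ge_of_cube[OF l, of e])
    fix x :: "nat \<Rightarrow> real" assume x: "\<forall>j. x j \<in> {0..l}"
    have "g i (x (i - 1)) \<in> mspace (T i)" if i: "i \<in> {1..n}" for i
      using g[OF i] x ld[OF i] by (meson atLeastAtMost_iff image_subset_iff order_trans)
    then show "e x \<in> mspace (l2_product {1..n} T)"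
      by (simp add: mspace_l2_product e_def)
    fix y :: "nat \<Rightarrow> real" assume y: "\<forall>j. y j \<in> {0..l}"
    have "L2_set (\<lambda>i. \<bar>x (i - 1) - y (i - 1)\<bar>) {1..n} \<le> (\<Sum>i\<in>{1..n}. \<bar>x (i - 1) - y (i - 1)\<bar>)"
      by (rule L2_set_le_sum) simp
    also have "\<dots> = (\<Sum>j<n. \<bar>x j - y j\<bar>)"
      by (rule sum.reindex_bij_witness[of _ Suc "\<lambda>i. i - 1"]) auto
    finally show "mdist (l2_product {1..n} T) (e x) (e y) \<le> (\<Sum>j<n. \<bar>x j - y j\<bar>)"
      by (simp only: dist[OF x y])
    fix j assume "j < n"
    then show "\<bar>x j - y j\<bar> \<le> mdist (l2_product {1..n} T) (e x) (e y)"
      unfolding dist[OF x y]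
      using member_le_L2_set[of "{1..n}" "Suc j" "\<lambda>i. \<bar>x (i - 1) - y (i - 1)\<bar>"] by simp
  qed
qed


section \<open>The dimension of a product of trees\<close>

theorem proposition3p2:
  fixes T :: "nat \<Rightarrow> 'a metric" and n :: nat
  assumes "\<forall>i\<in>{1..n}. metric_tree (T i)"
    and "\<forall>i\<in>{1..n}. \<exists>x\<in>mspace (T i). \<exists>y\<in>mspace (T i). x \<noteq> y"
  shows "nagata_dim (l2_product {1..n} T) = ereal (real n)"
proof (rule antisym)
  show "nagata_dim (l2_product {1..n} T) \<le> ereal (real n)"
    by (rule order_trans[OF nagata_dim_l2_product_trees_le]) (use assms in auto)
  show "ereal (real n) \<le> nagata_dim (l2_product {1..n} T)"
    by (rule nagata_dim_l2_product_geodesic_ge) (use assms in \<open>auto simp: metric_tree_def\<close>)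
qed

end
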